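(* Let $p\geq 1$, $A>0$, and let $0<a_1\leq\dots\leq a_p$ and $0<b_1\leq\dots\leq b_p$ satisfy $\sum_{j=1}^kb_j-\sum_{j=1}^ka_j\geq 0$ for $k=1,\dots,p$. Suppose that $$\prod_{i=1}^{p}\left[\frac{\Gamma(a_i+A)}{\Gamma(b_i+A)}-\frac{\Gamma(a_i+2A)}{\Gamma(b_i+2A)}(1-e)\right]\leq\prod_{i=1}^{p}\frac{\Gamma(a_i)}{\Gamma(b_i)}.$$ Then the function $${}_p\tilde{\Psi}_{p+1}\left[{(a_1,A),\dots,(a_p,A)\atop (2,1),(b_1,A),\dots,(b_p,A)}\Big|z\right]$$ is convex in $\mathcal{D}_{1/2}=\{z\in\mathbb{C}:|z|<1/2\}$.
   Context: The normalized Fox-Wright function is $${}_p\tilde{\Psi}_q\left[{(a_1,A_1),\dots,(a_p,A_p)\atop (b_1,B_1),\dots,(b_q,B_q)}\Big|z\right]=\frac{\prod_{j=1}^q\Gamma(b_j)}{\prod_{i=1}^p\Gamma(a_i)}\sum_{k=0}^\infty\frac{\prod_{i=1}^p\Gamma(a_i+kA_i)}{\prod_{j=1}^q\Gamma(b_j+kB_j)}\frac{z^{k+1}}{k!}.$$ A function $f(z)=z+\sum_{k\ge2}a_kz^k$ analytic in the unit disc is convex in $\mathcal{D}_{1/2}$ if it is univalent in $\mathcal{D}_{1/2}$ and $f(\mathcal{D}_{1/2})$ is a convex domain; equivalently $\Re\left(1+zf''(z)/f'(z)\right)>0$ for $|z|<1/2$. Here $e=\exp(1)$. *)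

theory Defs
  imports "HOL-Complex_Analysis.Complex_Analysis"
begin

text \<open>
  The normalized Fox--Wright function for real parameters. The first list holds the pairs
  \<open>(a\<^sub>i, A\<^sub>i)\<close>, the second the pairs \<open>(b\<^sub>j, B\<^sub>j)\<close>. The power of \<open>z\<close> in the \<open>k\<close>-th term is \<open>k + 1\<close>,
  so that the power series begins with \<open>z\<close>. As usual for \<^const>\<open>suminf\<close>, the value is
  meaningful only where the series converges.
\<close>

definition fox_wright_normalized ::
    "(real \<times> real) list \<Rightarrow> (real \<times> real) list \<Rightarrow> complex \<Rightarrow> complex" where
  "fox_wright_normalized as bs z =
     of_real ((\<Prod>(b, B)\<leftarrow>bs. Gamma b) / (\<Prod>(a, A)\<leftarrow>as. Gamma a)) *
     (\<Sum>k. of_real ((\<Prod>(a, A)\<leftarrow>as. Gamma (a + real k * A)) /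
                     (\<Prod>(b, B)\<leftarrow>bs. Gamma (b + real k * B))) * (z ^ (k + 1) / fact k))"

text \<open>
  The conditions \<open>f 0 = 0\<close> and \<open>f'(0) = 1\<close> express \<open>f(z) = z + \<Sum>\<^sub>k\<^sub>\<ge>\<^sub>2 a\<^sub>k z\<^sup>k\<close> for \<open>f\<close> analytic in the
  unit disc. A convex domain is an open convex set, and univalent means analytic and injective.
\<close>

definition convex_in_half_disc :: "(complex \<Rightarrow> complex) \<Rightarrow> bool" where
  "convex_in_half_disc f \<longleftrightarrow>
     f holomorphic_on ball 0 1 \<and> f 0 = 0 \<and> deriv f 0 = 1 \<and>
     inj_on f (ball 0 (1/2)) \<and> open (f ` ball 0 (1/2)) \<and> convex (f ` ball 0 (1/2))"

end

theory Submission
  imports Defs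
begin

text \<open>
  With \<open>g\<^sub>k = \<Prod>\<^sub>i \<Gamma>(a\<^sub>i + kA) / \<Gamma>(b\<^sub>i + kA)\<close> the function \<open>f\<close> in question has derivative
  \<open>f'(z) = \<Sum>\<^sub>k d\<^sub>k z\<^sup>k\<close>, where \<open>d\<^sub>k = g\<^sub>k / (g\<^sub>0 k!\<^sup>2)\<close>. Since \<open>x \<mapsto> ln \<Gamma>(x + A) - ln \<Gamma>(x)\<close> is
  increasing and concave, the weak majorization between \<open>a\<close> and \<open>b\<close> makes \<open>g\<close> nonincreasing, and the
  hypothesis on the products then gives \<open>\<Sum>\<^sub>k\<^sub>\<ge>\<^sub>1 d\<^sub>k \<le> (g\<^sub>1 + (e - 1) g\<^sub>2) / g\<^sub>0 \<le> 1\<close>.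

  For \<open>\<bar>z\<bar> < 1/2\<close> and \<open>k \<ge> 1\<close> we have \<open>(k + 1) \<bar>z\<bar>\<^sup>k \<le> 1\<close>, so \<open>\<bar>z f''(z)\<bar> + \<bar>f'(z) - 1\<bar> \<le> 1\<close>; hence
  \<open>\<bar>z f''(z)\<bar> \<le> \<bar>f'(z)\<bar>\<close> and \<open>\<bar>f'(z) - 1\<bar> \<le> 1/2\<close>. The second bound makes \<open>f\<close> injective. The first makes
  \<open>\<bar>f\<^sup>-\<^sup>1\<bar>\<^sup>2\<close> a convex function on every segment in the image, so that a segment in the image
  joining images of points of a closed disc around \<open>0\<close> stays in the image of that disc. Growing the segments
  \<open>[f(sx), f(sy)]\<close> from \<open>s = 0\<close> to \<open>s = 1\<close>, they can therefore never leave the image.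
\<close>

section \<open>Gamma ratios under weak majorization\<close>

text \<open>Abel summation, run as an induction: the partial sums of \<open>x\<close> are
  nonnegative, so replacing the weight \<open>w k\<close> in front of them by the smaller
  \<open>w (Suc k)\<close> only lowers the bound.\<close>

lemma sum_mult_ge_0_of_partial_sums:
  fixes w x :: "nat \<Rightarrow> real"
  assumes anti: "\<And>i j. 1 \<le> i \<Longrightarrow> i \<le> j \<Longrightarrow> j \<le> p \<Longrightarrow> w j \<le> w i"
    and nonneg: "\<And>i. 1 \<le> i \<Longrightarrow> i \<le> p \<Longrightarrow> 0 \<le> w i"
    and partial: "\<And>k. 1 \<le> k \<Longrightarrow> k \<le> p \<Longrightarrow> 0 \<le> (\<Sum>j=1..k. x j)"
  shows "0 \<le> (\<Sum>i=1..p. w i * x i)"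
proof -
  have partial_le: "w k * (\<Sum>j=1..k. x j) \<le> (\<Sum>i=1..k. w i * x i)" if "1 \<le> k" "k \<le> p" for k
    using that
  proof (induction k rule: dec_induct)
    case base
    then show ?case by simp
  next
    case (step k)
    have "w (Suc k) * (\<Sum>j=1..k. x j) \<le> w k * (\<Sum>j=1..k. x j)"
      using step anti[of k "Suc k"] partial[of k] by (intro mult_right_mono) auto
    with step show ?case by (simp add: algebra_simps)
  qed
  show ?thesis
  proof (cases "p = 0")
    case False
    then have "0 \<le> w p * (\<Sum>j=1..p. x j)"
      using nonneg partial by (intro mult_nonneg_nonneg) auto
    with False partial_le[of p] show ?thesis by simp
  qed simp
qed

text \<open>The increment of \<open>ln_Gamma\<close> over a step \<open>A\<close> is concave,
  because the trigamma function \<open>Polygamma 1\<close> decreases; its graph therefore lies below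
  its tangent at \<open>y\<close>.\<close>

lemma ln_Gamma_increment_tangent:
  fixes A x y :: real
  assumes "0 < A" "0 < x" "0 < y"
  shows "(Digamma (y + A) - Digamma y) * (y - x)
    \<le> (ln_Gamma (y + A) - ln_Gamma y) - (ln_Gamma (x + A) - ln_Gamma x)"
proof -
  have "(Digamma y - Digamma (y + A)) * (x - y)
      \<le> (ln_Gamma x - ln_Gamma (x + A)) - (ln_Gamma y - ln_Gamma (y + A))"
  proof (rule f''_imp_f'[where C = "{0<..}"
        and f'' = "\<lambda>t. Polygamma 1 t - Polygamma 1 (t + A)"])
    fix t :: real assume t: "t \<in> {0<..}"
    then have t': "t \<notin> \<int>\<^sub>\<le>\<^sub>0" "t + A \<notin> \<int>\<^sub>\<le>\<^sub>0" using assms by (auto elim!: nonpos_Ints_cases)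
    show "((\<lambda>t. ln_Gamma t - ln_Gamma (t + A)) has_real_derivative
        Digamma t - Digamma (t + A)) (at t)"
      using t assms by (auto intro!: derivative_eq_intros)
    show "((\<lambda>t. Digamma t - Digamma (t + A)) has_real_derivative
        Polygamma 1 t - Polygamma 1 (t + A)) (at t)"
      using t' by (auto intro!: derivative_eq_intros)
    show "0 \<le> Polygamma 1 t - Polygamma 1 (t + A)"
      using Polygamma_real_strict_antimono[of t "t + A" 1] t assms by simp
  qed (use assms in auto)
  then show ?thesis by (simp add: algebra_simps)
qed

text \<open>After taking logarithms, the tangents at the points \<open>b i\<close> reduce the claim
  to nonnegativity of a weighted sum of the differences \<open>b i - a i\<close>. The weights,
  increments of \<open>Digamma\<close> at \<open>b i\<close>, are nonnegative and do not increase
  along the sorted \<open>b\<close>, so Abel summation applies.\<close>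

lemma prod_Gamma_ratio_shift_le:
  fixes a b :: "nat \<Rightarrow> real" and A :: real
  assumes A: "0 < A"
    and pos: "\<And>i. i \<in> {1..p} \<Longrightarrow> 0 < a i" "\<And>i. i \<in> {1..p} \<Longrightarrow> 0 < b i"
    and mono: "mono_on {1..p} b"
    and partial: "\<And>k. k \<in> {1..p} \<Longrightarrow> 0 \<le> (\<Sum>j=1..k. b j) - (\<Sum>j=1..k. a j)"
  shows "(\<Prod>i=1..p. Gamma (a i + A) / Gamma (b i + A)) \<le> (\<Prod>i=1..p. Gamma (a i) / Gamma (b i))"
proof -
  have exp: "(\<Prod>i=1..p. Gamma (a i + c) / Gamma (b i + c))
      = exp (\<Sum>i=1..p. ln_Gamma (a i + c) - ln_Gamma (b i + c))" if "0 \<le> c" for c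
    unfolding exp_sum[OF finite_atLeastAtMost]
    using pos that by (intro prod.cong refl) (simp add: Gamma_real_pos_exp exp_diff add_pos_nonneg)
  have "0 \<le> (\<Sum>i=1..p. (Digamma (b i + A) - Digamma (b i)) * (b i - a i))"
  proof (rule sum_mult_ge_0_of_partial_sums)
    fix i j assume ij: "1 \<le> i" "i \<le> j" "j \<le> p"
    then have bij: "0 < b i" "b i \<le> b j" using pos mono by (auto intro: mono_onD)
    show "Digamma (b j + A) - Digamma (b j) \<le> Digamma (b i + A) - Digamma (b i)"
    proof (rule DERIV_nonpos_imp_nonincreasing[OF bij(2)])
      fix t assume t: "b i \<le> t" "t \<le> b j"
      then have t': "t \<notin> \<int>\<^sub>\<le>\<^sub>0" "t + A \<notin> \<int>\<^sub>\<le>\<^sub>0" using bij A by (auto elim!: nonpos_Ints_cases)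
      have "((\<lambda>t. Digamma (t + A) - Digamma t) has_real_derivative
          Polygamma 1 (t + A) - Polygamma 1 t) (at t)"
        using t' by (auto intro!: derivative_eq_intros)
      moreover have "Polygamma 1 (t + A) - Polygamma 1 t \<le> 0"
        using Polygamma_real_strict_antimono[of t "t + A" 1] t bij A by simp
      ultimately show "\<exists>y. ((\<lambda>t. Digamma (t + A) - Digamma t) has_real_derivative y) (at t) \<and> y \<le> 0"
        by blast
    qed
  next
    fix i assume "1 \<le> i" "i \<le> p"
    then show "0 \<le> Digamma (b i + A) - Digamma (b i)"
      using pos(2)[of i] A by (simp add: Digamma_real_mono)
  next
    fix k assume "1 \<le> k" "k \<le> p"
    then show "0 \<le> (\<Sum>j=1..k. b j - a j)" using partial[of k] by (simp add: sum_subtractf)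
  qed
  also have "\<dots> \<le> (\<Sum>i=1..p. (ln_Gamma (b i + A) - ln_Gamma (b i))
      - (ln_Gamma (a i + A) - ln_Gamma (a i)))"
    using pos A by (intro sum_mono ln_Gamma_increment_tangent) auto
  finally have "(\<Sum>i=1..p. ln_Gamma (a i + A) - ln_Gamma (b i + A))
      \<le> (\<Sum>i=1..p. ln_Gamma (a i + 0) - ln_Gamma (b i + 0))"
    by (simp add: sum_subtractf)
  then show ?thesis using exp[of A] exp[of 0] A by simp
qed

text \<open>Expand the right-hand product and drop the mixed terms; the power of \<open>t\<close>
  left in front of the product of the \<open>y i\<close> is at least \<open>t\<close>.\<close>

lemma prod_add_mult_ge:
  fixes x y :: "'i \<Rightarrow> real"
  assumes "finite I" "I \<noteq> {}" "1 \<le> t" "\<And>i. i \<in> I \<Longrightarrow> 0 \<le> x i" "\<And>i. i \<in> I \<Longrightarrow> 0 \<le> y i"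
  shows "(\<Prod>i\<in>I. x i) + t * (\<Prod>i\<in>I. y i) \<le> (\<Prod>i\<in>I. x i + t * y i)"
  using assms
proof (induction I rule: finite_ne_induct)
  case (insert i I)
  let ?X = "\<Prod>i\<in>I. x i" and ?Y = "\<Prod>i\<in>I. y i"
  have nn: "0 \<le> ?X" "0 \<le> ?Y" "0 \<le> x i" "0 \<le> y i"
    using insert.prems by (auto intro!: prod_nonneg)
  have "t * (y i * ?Y) \<le> t * (t * (y i * ?Y))"
    using nn insert.prems(1) mult_right_mono[of 1 t "y i * ?Y"] by (intro mult_left_mono) auto
  moreover have "0 \<le> t * (x i * ?Y)" "0 \<le> t * (y i * ?X)" using nn insert.prems(1) by auto
  ultimately have "x i * ?X + t * (y i * ?Y) \<le> (x i + t * y i) * (?X + t * ?Y)"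
    by (simp add: algebra_simps)
  also have "\<dots> \<le> (x i + t * y i) * (\<Prod>i\<in>I. x i + t * y i)"
    using insert nn by (intro mult_left_mono) auto
  finally show ?case using insert by simp
qed simp

section \<open>Convexity of the image of a disc\<close>

text \<open>Pull the segment back to the curve \<open>G\<close> in the disc, with velocity
  \<open>V\<close> and acceleration \<open>W\<close>. The bound on f'' makes |G| |W| at most |V|^2,
  so |G|^2 has nonnegative second derivative, and a convex function is bounded by its end
  values.\<close>

lemma preimage_norm_le_on_segment:
  fixes f g :: "complex \<Rightarrow> complex"
  assumes holf: "f holomorphic_on ball 0 R" and opn: "open (f ` ball 0 R)"
    and bound: "\<And>z. z \<in> ball 0 R \<Longrightarrow> norm (z * deriv (deriv f) z) \<le> norm (deriv f z)"
    and holg: "g holomorphic_on f ` ball 0 R"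
    and dg: "\<And>z. z \<in> ball 0 R \<Longrightarrow> deriv f z * deriv g (f z) = 1"
    and gf: "\<And>z. z \<in> ball 0 R \<Longrightarrow> g (f z) = z"
    and seg: "closed_segment u v \<subseteq> f ` ball 0 R"
    and ends: "norm (g u) \<le> r" "norm (g v) \<le> r"
    and w: "w \<in> closed_segment u v"
  shows "norm (g w) \<le> r"
proof -
  define l where "l t = u + of_real t * (v - u)" for t :: real
  define G where "G t = g (l t)" for t
  define V where "V t = (v - u) * deriv g (l t)" for t
  define W where "W t = (v - u) * ((v - u) * deriv (deriv g) (l t))" for t
  have l_in: "l t \<in> f ` ball 0 R" if "t \<in> {0..1}" for t
  proof -
    have "l t \<in> closed_segment u v"
      using that by (force simp: l_def in_segment scaleR_conv_of_real algebra_simps)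
    then show ?thesis using seg by blast
  qed
  have dl: "(l has_vector_derivative (v - u)) (at t)" for t
    unfolding l_def by (auto intro!: derivative_eq_intros)
  have dG: "(G has_vector_derivative V t) (at t)" if "t \<in> {0..1}" for t
    unfolding G_def V_def
    using field_vector_diff_chain_at[OF dl holomorphic_derivI[OF holg opn l_in[OF that]]]
    by (simp add: o_def)
  have dV: "(V has_vector_derivative W t) (at t)" if "t \<in> {0..1}" for t
  proof -
    have "deriv g holomorphic_on f ` ball 0 R"
      using holg opn by (rule holomorphic_deriv)
    from field_vector_diff_chain_at[OF dl holomorphic_derivI[OF this opn l_in[OF that]]]
    show ?thesis
      unfolding V_def W_def o_def
      by (intro has_vector_derivative_mult_right) simp
  qed
  \<comment> \<open>Obtained by differentiating f'(z) g'(f(z)) = 1 and multiplying by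
    g'(f(z)).\<close>
  have ddg: "deriv (deriv g) (f z) * deriv f z = - deriv (deriv f) z * (deriv g (f z))\<^sup>2"
    if z: "z \<in> ball 0 R" for z
  proof -
    have f': "(f has_field_derivative deriv f z) (at z)"
      using holomorphic_derivI[OF holf open_ball z] by simp
    have "deriv f holomorphic_on ball 0 R"
      using holf by (intro holomorphic_deriv) auto
    from holomorphic_derivI[OF this open_ball z]
    have f'': "(deriv f has_field_derivative deriv (deriv f) z) (at z)" by simp
    have "deriv g holomorphic_on f ` ball 0 R"
      using holg opn by (rule holomorphic_deriv)
    from holomorphic_derivI[OF this opn imageI[OF z]]
    have g'': "(deriv g has_field_derivative deriv (deriv g) (f z)) (at (f z))" by simp
    have "((\<lambda>z. deriv f z * deriv g (f z)) has_field_derivative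
        deriv (deriv f) z * deriv g (f z) + deriv (deriv g) (f z) * deriv f z * deriv f z) (at z)"
      using DERIV_mult[OF f'' DERIV_chain2[OF g'' f']] by simp
    moreover have "((\<lambda>z. deriv f z * deriv g (f z)) has_field_derivative 0) (at z)"
    proof (rule has_field_derivative_transform_within_open[where S = "ball 0 R"])
      show "((\<lambda>_. 1) has_field_derivative 0) (at z)" by simp
    qed (use z dg in auto)
    ultimately have "deriv (deriv f) z * deriv g (f z)
        + deriv (deriv g) (f z) * deriv f z * deriv f z = 0"
      by (rule DERIV_unique)
    then have "deriv (deriv f) z * deriv g (f z) * deriv g (f z)
        + deriv (deriv g) (f z) * deriv f z * (deriv f z * deriv g (f z)) = 0"
      by algebra
    then show ?thesis
      using dg[OF z] by (simp add: power2_eq_square add_eq_0_iff)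
  qed
  have pos: "0 \<le> 2 * (V t \<bullet> V t + G t \<bullet> W t)" if t: "t \<in> {0..1}" for t
  proof -
    obtain z where z: "z \<in> ball 0 R" and lt: "l t = f z" using l_in[OF t] by auto
    have f0: "deriv f z \<noteq> 0" using dg[OF z] by auto
    have Gz: "G t = z" using gf[OF z] lt by (simp add: G_def)
    \<comment> \<open>The extra factor |f'(z)| turns g'' into f'' through \<open>ddg\<close>; it is
      nonzero and cancels at the end.\<close>
    have "norm (G t) * norm (W t) * norm (deriv f z)
        = norm (v - u) ^ 2 * norm z * norm (deriv (deriv g) (f z) * deriv f z)"
      by (simp add: Gz W_def lt norm_mult power2_eq_square)
    also have "\<dots> = norm (V t) ^ 2 * norm (z * deriv (deriv f) z)"
      unfolding ddg[OF z] by (simp add: V_def lt norm_mult norm_power power_mult_distrib)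
    also have "\<dots> \<le> norm (V t) ^ 2 * norm (deriv f z)"
      using bound[OF z] by (intro mult_left_mono) auto
    finally have "norm (G t) * norm (W t) \<le> norm (V t) ^ 2"
      using f0 by simp
    moreover have "- (G t \<bullet> W t) \<le> norm (G t) * norm (W t)"
      using norm_cauchy_schwarz[of "- G t" "W t"] by simp
    moreover have "V t \<bullet> V t = norm (V t) ^ 2" by (simp add: power2_norm_eq_inner)
    ultimately show ?thesis by simp
  qed
  have conv: "convex_on {0..1} (\<lambda>t. G t \<bullet> G t)"
  proof (rule f''_ge0_imp_convex)
    fix t :: real assume t: "t \<in> {0..1}"
    show "((\<lambda>t. G t \<bullet> G t) has_real_derivative 2 * (G t \<bullet> V t)) (at t)"
      using bounded_bilinear.has_vector_derivative[OF bounded_bilinear_inner dG[OF t] dG[OF t]]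
      by (simp add: has_real_derivative_iff_has_vector_derivative inner_commute)
    show "((\<lambda>t. 2 * (G t \<bullet> V t)) has_real_derivative 2 * (V t \<bullet> V t + G t \<bullet> W t)) (at t)"
      using bounded_bilinear.has_vector_derivative[OF bounded_bilinear_inner dG[OF t] dV[OF t]]
      by (intro DERIV_cmult)
        (simp add: has_real_derivative_iff_has_vector_derivative add.commute)
    show "0 \<le> 2 * (V t \<bullet> V t + G t \<bullet> W t)" using pos[OF t] .
  qed simp
  obtain t where t: "t \<in> {0..1}" and wt: "w = l t"
    using w by (auto simp: l_def in_segment scaleR_conv_of_real algebra_simps)
  have ends2: "G 0 \<bullet> G 0 \<le> r\<^sup>2" "G 1 \<bullet> G 1 \<le> r\<^sup>2"
    using ends by (auto simp: G_def l_def simp flip: power2_norm_eq_inner intro!: power_mono)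
  have "G t \<bullet> G t \<le> (1 - t) * (G 0 \<bullet> G 0) + t * (G 1 \<bullet> G 1)"
    using convex_onD[OF conv, of t 0 1] t by simp
  also have "\<dots> \<le> (1 - t) * r\<^sup>2 + t * r\<^sup>2"
    using t ends2 by (intro add_mono mult_left_mono) auto
  finally have "norm (g w) ^ 2 \<le> r ^ 2"
    by (simp add: G_def wt power2_norm_eq_inner algebra_simps)
  moreover have "0 \<le> r" using ends(1) norm_ge_zero order_trans by blast
  ultimately show ?thesis by (rule power2_le_imp_le)
qed

text \<open>Connectedness of [0,1]: \<open>S\<close> collects the s whose segment from f(sx) to
  f(sy) lies in the image of a smaller closed disc, \<open>T\<close> those whose segment leaves the
  image of the open one. Both are closed, they are disjoint and cover [0,1], and 0 lies in
  \<open>S\<close>; hence so does 1.\<close>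

lemma convex_image_ball:
  fixes f :: "complex \<Rightarrow> complex"
  assumes holf: "f holomorphic_on ball 0 R" and inj: "inj_on f (ball 0 R)"
    and bound: "\<And>z. z \<in> ball 0 R \<Longrightarrow> norm (z * deriv (deriv f) z) \<le> norm (deriv f z)"
  shows "convex (f ` ball 0 R)"
  unfolding convex_contains_segment
proof (intro ballI)
  fix u v assume "u \<in> f ` ball 0 R" "v \<in> f ` ball 0 R"
  then obtain x y where x: "x \<in> ball 0 R" "u = f x" and y: "y \<in> ball 0 R" "v = f y" by auto
  have opn: "open (f ` ball 0 R)" using holf inj by (intro open_mapping_thm3) auto
  obtain g where holg: "g holomorphic_on f ` ball 0 R"
    and dg: "\<And>z. z \<in> ball 0 R \<Longrightarrow> deriv f z * deriv g (f z) = 1"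
    and gf: "\<And>z. z \<in> ball 0 R \<Longrightarrow> g (f z) = z"
    using holomorphic_has_inverse[OF holf open_ball inj] by blast
  \<comment> \<open>The closed disc of radius \<open>r\<close> contains all points sx and sy, yet is
    compact inside the open ball, so its image is closed.\<close>
  define r where "r = max (norm x) (norm y)"
  have r: "norm x \<le> r" "norm y \<le> r" "r < R" "0 \<le> r"
    using x y by (auto simp: r_def le_max_iff_disj)
  define H where "H = (\<lambda>(s, t). (1 - t) *\<^sub>R f (s *\<^sub>R x) + t *\<^sub>R f (s *\<^sub>R y))"
  define S where "S = {s \<in> {0..1}. \<forall>t\<in>{0..1}. H (s, t) \<in> f ` cball 0 r}"
  define C where "C = {0..1} \<times> {0..1} \<inter> H -` (- f ` ball 0 R)"
  define T where "T = fst ` C"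
  have scal: "norm (s *\<^sub>R x) \<le> r" "norm (s *\<^sub>R y) \<le> r" if "s \<in> {0..1}" for s :: real
    using that r mult_left_le_one_le[of "norm x" s] mult_left_le_one_le[of "norm y" s] by auto
  have contf: "continuous_on (ball 0 R) f"
    using holf by (rule holomorphic_on_imp_continuous_on)
  have fs: "continuous_on ({0..1} \<times> {0..1}) (\<lambda>p::real \<times> real. f (fst p *\<^sub>R z))"
    if "\<And>s. s \<in> {0..1} \<Longrightarrow> norm (s *\<^sub>R z) \<le> r" for z
    by (rule continuous_on_compose2[OF contf])
      (use that r(3) in \<open>force intro!: continuous_intros\<close>)+
  have contH: "continuous_on ({0..1} \<times> {0..1}) H"
    unfolding H_def case_prod_unfold
    by (intro continuous_intros fs) (use scal in auto)
  \<comment> \<open>Closed in the unit square, \<open>C\<close> is compact; hence its projection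
    \<open>T\<close> to the first coordinate is closed.\<close>
  have "closed C"
    unfolding C_def
    by (intro continuous_closed_preimage[OF contH]) (use opn in \<open>auto intro: closed_Times\<close>)
  moreover have "C = {0..1} \<times> {0..1} \<inter> C" by (auto simp: C_def)
  ultimately have "compact C"
    using compact_Int_closed[OF compact_Times[OF compact_Icc compact_Icc]] by metis
  then have closedT: "closed T"
    unfolding T_def
    by (intro compact_imp_closed compact_continuous_image continuous_on_fst continuous_on_id)
  have closedK: "closed (f ` cball 0 r)"
    by (intro compact_imp_closed compact_continuous_image continuous_on_subset[OF contf])
      (use r in auto)
  have "closed {s \<in> {0..1}. H (s, t) \<in> f ` cball 0 r}" if "t \<in> {0..1}" for t
  proof -
    have "continuous_on {0..1} (\<lambda>s. H (s, t))"
      by (rule continuous_on_compose2[OF contH]) (use that in \<open>auto intro!: continuous_intros\<close>)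
    from continuous_closed_preimage[OF this _ closedK] show ?thesis
      by (simp add: vimage_def Int_def)
  qed
  then have "closed (\<Inter>t\<in>{0..1}. {s \<in> {0..1}. H (s, t) \<in> f ` cball 0 r})" by blast
  also have "(\<Inter>t\<in>{0..1}. {s \<in> {0..1}. H (s, t) \<in> f ` cball 0 r}) = S"
    by (force simp: S_def)
  finally have closedS: "closed S" .
  have cover: "{0..1} \<subseteq> S \<union> T"
  proof
    fix s :: real assume s: "s \<in> {0..1}"
    show "s \<in> S \<union> T"
    proof (cases "s \<in> T")
      \<comment> \<open>A segment that never meets the complement lies in the domain of the inverse
        \<open>g\<close>, so the radius bound passes from its ends to all of it.\<close>
      case False
      have Ht: "H (s, t) \<in> f ` ball 0 R" if "t \<in> {0..1}" for t
        using False s that unfolding T_def C_def by force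
      have sx: "s *\<^sub>R x \<in> ball 0 R" "s *\<^sub>R y \<in> ball 0 R"
        using scal[OF s] r(3) by auto
      have seg: "closed_segment (f (s *\<^sub>R x)) (f (s *\<^sub>R y)) \<subseteq> f ` ball 0 R"
        using Ht by (auto simp: closed_segment_def H_def)
      have "H (s, t) \<in> f ` cball 0 r" if t: "t \<in> {0..1}" for t
      proof -
        have "norm (g (H (s, t))) \<le> r"
          by (rule preimage_norm_le_on_segment[OF holf opn bound holg dg gf seg])
            (use t scal[OF s] gf[OF sx(1)] gf[OF sx(2)] in \<open>auto simp: closed_segment_def H_def\<close>)
        moreover obtain z where "z \<in> ball 0 R" "H (s, t) = f z" using Ht[OF t] by auto
        ultimately show ?thesis using gf by auto
      qed
      then show ?thesis using s by (auto simp: S_def)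
    qed simp
  qed
  have disj: "S \<inter> T \<inter> {0..1} = {}"
  proof -
    have "f ` cball 0 r \<subseteq> f ` ball 0 R" using r by (intro image_mono) auto
    then show ?thesis by (force simp: S_def T_def C_def)
  qed
  \<comment> \<open>At s = 0 the segment shrinks to the point \<open>f 0\<close>.\<close>
  have "0 \<in> S \<inter> {0..1}"
    using r by (auto simp: S_def H_def simp flip: scaleR_left_distrib)
  then have "T \<inter> {0..1} = {}"
    using connected_closedD[OF connected_Icc disj cover closedS closedT] by blast
  moreover have "1 \<in> S \<union> T" using cover by (rule subsetD) simp
  ultimately have "1 \<in> S" by auto
  then have "H (1, t) \<in> f ` cball 0 r" if "t \<in> {0..1}" for t
    using that by (auto simp: S_def)
  then have "closed_segment u v \<subseteq> f ` cball 0 r"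
    by (auto simp: H_def closed_segment_def x y)
  also have "\<dots> \<subseteq> f ` ball 0 R" using r by (intro image_mono) auto
  finally show "closed_segment u v \<subseteq> f ` ball 0 R" .
qed

section \<open>Coefficient criterion for convexity in the half disc\<close>

text \<open>\<open>d\<close> lists the Taylor coefficients of f', so their tail sum controls f' - 1
  and, on the half disc, also z f''.\<close>

lemma convex_in_half_disc_of_coefficients:
  fixes d :: "nat \<Rightarrow> real" and f :: "complex \<Rightarrow> complex"
  assumes nonneg: "\<And>n. 0 \<le> d n" and d0: "d 0 = 1" and sum_d: "summable d"
    and le1: "(\<Sum>n. d (Suc n)) \<le> 1"
    and f: "\<And>z. norm z < 1 \<Longrightarrow> f z = (\<Sum>n. of_real (d n) / of_nat (Suc n) * z ^ Suc n)"
  shows "convex_in_half_disc f"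
proof -
  define D where "D n = complex_of_real (d n)" for n
  \<comment> \<open>Taylor coefficients of \<open>f\<close> itself, shifted by one because its
    series starts with z; this gives \<open>diffs c = D\<close>.\<close>
  define c :: "nat \<Rightarrow> complex" where "c n = (if n = 0 then 0 else D (n - 1) / of_nat n)" for n
  define E where "E z = (\<Sum>n. D n * z ^ n)" for z
  define E' where "E' z = (\<Sum>n. diffs D n * z ^ n)" for z
  have sum_D: "summable D" unfolding D_def using sum_d by (rule summable_of_real)
  \<comment> \<open>Summability at the point 1 is what termwise differentiation in the whole open
    unit disc rests on.\<close>
  have "summable (\<lambda>n. c (Suc n))"
  proof (rule summable_comparison_test'[OF sum_d])
    fix n
    show "norm (c (Suc n)) \<le> d n"
      using nonneg[of n] divide_left_mono[of 1 "real (Suc n)" "d n"]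
      by (simp add: c_def D_def norm_divide del: of_nat_Suc)
  qed
  then have sum_c: "summable c" by (simp only: summable_Suc_iff)
  have diffs_c: "diffs c = D" by (simp add: diffs_def c_def fun_eq_iff del: of_nat_Suc)
  have f_eq: "f z = (\<Sum>n. c n * z ^ n)" if "norm z < 1" for z
  proof -
    have "summable (\<lambda>n. c n * z ^ n)"
      by (rule powser_inside[of c 1]) (use sum_c that in simp_all)
    then have "(\<Sum>n. c (Suc n) * z ^ Suc n) = (\<Sum>n. c n * z ^ n) - c 0 * z ^ 0"
      by (rule suminf_split_head)
    moreover have "f z = (\<Sum>n. c (Suc n) * z ^ Suc n)"
      unfolding f[OF that] by (simp only: c_def D_def nat.distinct if_False diff_Suc_1)
    moreover have "c 0 = 0" by (simp add: c_def)
    ultimately show ?thesis by simp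
  qed
  have f': "(f has_field_derivative E z) (at z)" if z: "z \<in> ball 0 1" for z
  proof (rule has_field_derivative_transform_within_open[where S = "ball 0 1"])
    show "((\<lambda>z. \<Sum>n. c n * z ^ n) has_field_derivative E z) (at z)"
      using termdiffs_strong[of c 1 z] sum_c z by (simp add: diffs_c E_def)
  qed (use z f_eq in auto)
  have df: "deriv f z = E z" if "z \<in> ball 0 1" for z
    by (rule DERIV_imp_deriv[OF f'[OF that]])
  have E': "(E has_field_derivative E' z) (at z)" if z: "z \<in> ball 0 1" for z
    using termdiffs_strong[of D 1 z] sum_D z unfolding E_def E'_def by simp
  have ddf: "deriv (deriv f) z = E' z" if z: "z \<in> ball 0 1" for z
    by (intro DERIV_imp_deriv has_field_derivative_transform_within_open[OF E'[OF z] open_ball z])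
      (simp add: df)
  have hol1: "f holomorphic_on ball 0 1" using f' by (subst holomorphic_on_open) blast+
  then have hol: "f holomorphic_on ball 0 (1/2)" by (rule holomorphic_on_subset) auto
  have estimates: "norm (E z - 1) \<le> 1/2" "norm (z * E' z) \<le> norm (E z)"
    if z: "z \<in> ball 0 (1/2)" for z
  proof -
    \<comment> \<open>\<open>P\<close> and \<open>Q\<close> majorize the series of z f'' and of f' -
      1 term by term.\<close>
    define P where "P n = d (Suc n) * (real (Suc n) * norm z ^ Suc n)" for n
    define Q where "Q n = d (Suc n) * norm z ^ Suc n" for n
    have r: "norm z ^ n \<le> (1/2) ^ n" for n using z by (intro power_mono) auto
    \<comment> \<open>Here the radius 1/2 enters: with n + 1 for n this gives (n + 2) |z|^(n + 1) <=
      1.\<close>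
    have two: "real (n + 1) \<le> 2 ^ n" for n
      by (induction n) (auto simp: algebra_simps)
    have PQ: "P n + Q n \<le> d (Suc n)" for n
    proof -
      have "(real (Suc n) + 1) * norm z ^ Suc n \<le> 2 ^ Suc n * (1/2) ^ Suc n"
        using two[of "Suc n"] r[of "Suc n"] by (intro mult_mono) auto
      also have "\<dots> = 1" by (simp flip: power_mult_distrib)
      finally have "d (Suc n) * ((real (Suc n) + 1) * norm z ^ Suc n) \<le> d (Suc n) * 1"
        using nonneg by (intro mult_left_mono)
      then show ?thesis by (simp add: P_def Q_def algebra_simps)
    qed
    have nn: "0 \<le> P n" "0 \<le> Q n" for n using nonneg by (auto simp: P_def Q_def)
    have QP: "Q n \<le> P n" for n
      unfolding P_def Q_def using nonneg
      by (intro mult_left_mono) (auto simp: mult_le_cancel_right1 simp del: power_Suc)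
    have sd: "summable (\<lambda>n. d (Suc n))" using sum_d by (simp only: summable_Suc_iff)
    have sP: "summable P"
    proof (rule summable_comparison_test'[OF sd])
      show "norm (P n) \<le> d (Suc n)" for n using nn[of n] PQ[of n] by simp
    qed
    have sQ: "summable Q"
    proof (rule summable_comparison_test'[OF sd])
      show "norm (Q n) \<le> d (Suc n)" for n using nn[of n] PQ[of n] by simp
    qed
    have "suminf P + suminf Q = (\<Sum>n. P n + Q n)" using sP sQ by (rule suminf_add)
    also have "\<dots> \<le> (\<Sum>n. d (Suc n))" using PQ summable_add[OF sP sQ] sd by (rule suminf_le)
    finally have PQ1: "suminf P + suminf Q \<le> 1" using le1 by simp
    have QP': "suminf Q \<le> suminf P" using QP sQ sP by (rule suminf_le)
    have z1: "norm z < 1" using z by simp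
    have sE: "summable (\<lambda>n. D n * z ^ n)"
      by (rule powser_inside[of D 1]) (use sum_D z1 in simp_all)
    have "E z - 1 = (\<Sum>n. D (Suc n) * z ^ Suc n)"
      using suminf_split_head[OF sE] by (simp add: E_def D_def d0)
    also have "norm \<dots> \<le> suminf Q"
      by (intro norm_suminf_le sQ) (simp add: D_def Q_def norm_mult norm_power nonneg)
    finally have E1: "norm (E z - 1) \<le> suminf Q" .
    \<comment> \<open>The sum of \<open>Q\<close> is at most that of \<open>P\<close>, and together
      they are at most 1, so it is at most half.\<close>
    then show "norm (E z - 1) \<le> 1/2" using PQ1 QP' by simp
    have sE': "summable (\<lambda>n. diffs D n * z ^ n)"
      by (rule termdiff_converges[OF z1], rule powser_inside[of D 1]) (use sum_D in simp_all)
    have "z * E' z = (\<Sum>n. z * (diffs D n * z ^ n))"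
      unfolding E'_def using sE' by (rule suminf_mult[symmetric])
    also have "norm \<dots> \<le> suminf P"
      by (intro norm_suminf_le sP)
        (simp add: D_def P_def diffs_def norm_mult norm_power nonneg del: of_nat_Suc)
    also have "\<dots> \<le> 1 - norm (E z - 1)" using PQ1 E1 by simp
    also have "\<dots> \<le> norm (E z)" using norm_triangle_ineq2[of 1 "1 - E z"]
      by (simp add: norm_minus_commute)
    finally show "norm (z * E' z) \<le> norm (E z)" .
  qed
  have sub: "z \<in> ball 0 1" if "z \<in> ball 0 (1/2)" for z :: complex using that by auto
  have inj: "inj_on f (ball 0 (1/2))"
  proof (rule inj_onI)
    fix x y assume xy: "x \<in> ball 0 (1/2)" "y \<in> ball 0 (1/2)" "f x = f y"
    \<comment> \<open>On the convex disc, f minus the identity is Lipschitz with constant 1/2, so f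
      x = f y forces x = y.\<close>
    have "norm ((f x - x) - (f y - y)) \<le> 1/2 * norm (x - y)"
    proof (rule field_differentiable_bound[where S = "ball 0 (1/2)" and f' = "\<lambda>z. E z - 1"])
      fix z :: complex assume z: "z \<in> ball 0 (1/2)"
      show "((\<lambda>z. f z - z) has_field_derivative E z - 1) (at z within ball 0 (1/2))"
        by (rule has_field_derivative_at_within, intro DERIV_diff DERIV_ident f' sub z)
      show "norm (E z - 1) \<le> 1/2" using z by (rule estimates)
    qed (use xy in simp_all)
    then show "x = y" using xy(3) by (simp add: norm_minus_commute)
  qed
  have "convex (f ` ball 0 (1/2))"
    using hol inj by (rule convex_image_ball) (simp only: df ddf sub estimates)
  moreover have "open (f ` ball 0 (1/2))" using hol inj by (intro open_mapping_thm3) auto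
  moreover have "f 0 = 0" using f[of 0] by simp
  moreover have "deriv f 0 = 1"
    using powser_zero[of D] by (simp add: df E_def D_def d0)
  ultimately show ?thesis using hol1 inj by (simp add: convex_in_half_disc_def)
qed

section \<open>Application to the Fox-Wright function\<close>

text \<open>The pair (2, 1) contributes Gamma(k + 2) = (k + 1)!, which with the factor 1/k! gives
  the square of k! and the divisor \<open>Suc k\<close>; the prefactor is \<open>1 / g 0\<close>
  because Gamma(2) = 1.\<close>

lemma fox_wright_normalized_equal_steps:
  fixes a b :: "nat \<Rightarrow> real"
  assumes g: "\<And>k. g k = (\<Prod>i=1..p. Gamma (a i + real k * A) / Gamma (b i + real k * A))"
    and g0: "g 0 \<noteq> 0"
    and summable: "summable (\<lambda>k. complex_of_real (g k / g 0 / (fact k)\<^sup>2) * z ^ k / of_nat (Suc k))"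
  shows "fox_wright_normalized (map (\<lambda>i. (a i, A)) [1..<p+1])
      ((2, 1) # map (\<lambda>i. (b i, A)) [1..<p+1]) z
    = (\<Sum>k. of_real (g k / g 0 / (fact k)\<^sup>2) / of_nat (Suc k) * z ^ Suc k)"
proof -
  define T where "T k = complex_of_real (g k / fact (Suc k)) * (z ^ Suc k / fact k)" for k
  have prods: "(\<Prod>(x, y)\<leftarrow>map (\<lambda>i. (c i, A)) [1..<p+1]. h x y) = (\<Prod>i=1..p. h (c i) A)"
    for h :: "real \<Rightarrow> real \<Rightarrow> real" and c
  proof -
    have "{1..p} = set [1..<p+1]" by auto
    then show ?thesis
      by (simp only: prod.distinct_set_conv_list[OF distinct_upt] map_map o_def prod.case)
  qed
  have Gamma2: "Gamma (2 + real k * 1) = fact (Suc k)" for k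
    using Gamma_fact[of "Suc k", where 'a = real] by (simp add: add.assoc[symmetric])
  have T: "of_real ((\<Prod>i=1..p. Gamma (a i + real k * A)) /
      (Gamma (2 + real k * 1) * (\<Prod>i=1..p. Gamma (b i + real k * A)))) * (z ^ (k + 1) / fact k)
      = T k" for k
    unfolding T_def Gamma2 g prod_dividef by (simp add: mult.commute)
  have T': "T k = of_real (g 0) * (of_real (g k / g 0 / (fact k)\<^sup>2) / of_nat (Suc k) * z ^ Suc k)"
    for k
    using g0 by (simp add: T_def power2_eq_square field_simps del: of_nat_Suc)
  have "summable (\<lambda>k. of_real (g k / g 0 / (fact k)\<^sup>2) / of_nat (Suc k) * z ^ Suc k)"
    using summable_mult[OF summable, of z] by (simp add: mult_ac del: of_nat_Suc)
  from suminf_mult[OF this, of "of_real (g 0)"]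
  have "suminf T = of_real (g 0) * (\<Sum>k. of_real (g k / g 0 / (fact k)\<^sup>2) / of_nat (Suc k) * z ^ Suc k)"
    by (simp only: T'[symmetric])
  moreover have "fox_wright_normalized (map (\<lambda>i. (a i, A)) [1..<p+1])
      ((2, 1) # map (\<lambda>i. (b i, A)) [1..<p+1]) z = of_real (1 / g 0) * suminf T"
    unfolding fox_wright_normalized_def list.map prod_list.Cons prods prod.case T
    using Gamma2[of 0] by (simp add: g prod_dividef)
  ultimately show ?thesis using g0 by simp
qed

theorem theorem5:
  fixes p :: nat and A :: real and a b :: "nat \<Rightarrow> real"
  assumes "p \<ge> 1" and "A > 0"
    and "0 < a 1" and "mono_on {1..p} a"
    and "0 < b 1" and "mono_on {1..p} b"
    and "\<forall>k\<in>{1..p}. (\<Sum>j=1..k. b j) - (\<Sum>j=1..k. a j) \<ge> 0"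
    and "(\<Prod>i=1..p. Gamma (a i + A) / Gamma (b i + A)
            - Gamma (a i + 2 * A) / Gamma (b i + 2 * A) * (1 - exp 1))
         \<le> (\<Prod>i=1..p. Gamma (a i) / Gamma (b i))"
  shows "convex_in_half_disc
           (fox_wright_normalized (map (\<lambda>i. (a i, A)) [1..<p+1])
                                  ((2, 1) # map (\<lambda>i. (b i, A)) [1..<p+1]))"
proof -
  define g where "g k = (\<Prod>i=1..p. Gamma (a i + real k * A) / Gamma (b i + real k * A))" for k
  define d where "d k = g k / g 0 / (fact k)\<^sup>2" for k
  have a_pos: "0 < a i" if "i \<in> {1..p}" for i
    using mono_onD[OF assms(4), of 1 i] that assms(1,3) by simp
  have b_pos: "0 < b i" if "i \<in> {1..p}" for i
    using mono_onD[OF assms(6), of 1 i] that assms(1,5) by simp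
  have ratio_pos: "0 < Gamma (a i + real k * A) / Gamma (b i + real k * A)" if "i \<in> {1..p}" for i k
    using a_pos[OF that] b_pos[OF that] assms(2)
    by (intro divide_pos_pos Gamma_real_pos add_pos_nonneg) auto
  have g_pos: "0 < g k" for k
    unfolding g_def using ratio_pos by (intro prod_pos) auto
  have "g (Suc k) \<le> g k" for k
  proof -
    \<comment> \<open>A common shift of \<open>a\<close> and \<open>b\<close> by kA leaves the
      differences of partial sums unchanged, so the majorization survives.\<close>
    have "(\<Prod>i=1..p. Gamma ((a i + real k * A) + A) / Gamma ((b i + real k * A) + A))
        \<le> (\<Prod>i=1..p. Gamma (a i + real k * A) / Gamma (b i + real k * A))"
    proof (rule prod_Gamma_ratio_shift_le[OF assms(2)])
      show "0 < a i + real k * A" "0 < b i + real k * A" if "i \<in> {1..p}" for i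
        using a_pos[OF that] b_pos[OF that] assms(2) by (simp_all add: add_pos_nonneg)
      show "mono_on {1..p} (\<lambda>i. b i + real k * A)"
        using assms(6) by (auto simp: mono_on_def)
      show "0 \<le> (\<Sum>j=1..m. b j + real k * A) - (\<Sum>j=1..m. a j + real k * A)"
        if "m \<in> {1..p}" for m
        using assms(7) that by (simp add: sum.distrib)
    qed
    then show ?thesis by (simp add: g_def algebra_simps)
  qed
  then have anti: "g n \<le> g m" if "m \<le> n" for m n
    using that by (rule lift_Suc_antimono_le)
  \<comment> \<open>Makes the factor e - 1 at least 1, as \<open>prod_add_mult_ge\<close>
    demands.\<close>
  have e2: "2 \<le> exp (1::real)" using exp_ge_add_one_self[of 1] by simp
  have "g 1 + (exp 1 - 1) * g 2
      \<le> (\<Prod>i=1..p. Gamma (a i + real 1 * A) / Gamma (b i + real 1 * A)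
          + (exp 1 - 1) * (Gamma (a i + real 2 * A) / Gamma (b i + real 2 * A)))"
    unfolding g_def
    by (intro prod_add_mult_ge less_imp_le[OF ratio_pos]) (use assms(1) e2 in auto)
  also have "\<dots> \<le> g 0"
  proof -
    have "x + (exp 1 - 1) * y = x - y * (1 - exp 1)" for x y :: real
      by (simp add: algebra_simps)
    with assms(8) show ?thesis by (simp add: g_def)
  qed
  finally have key: "g 1 + (exp 1 - 1) * g 2 \<le> g 0" .
  \<comment> \<open>Since \<open>g\<close> is nonincreasing, \<open>M\<close> bounds g n / g 0 for
    all n >= 2.\<close>
  define M where "M = g 2 / g 0"
  have M: "0 \<le> M" using g_pos[of 0] g_pos[of 2] by (simp add: M_def)
  have exp_sums: "(\<lambda>n. inverse (fact n)) sums exp (1::real)"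
    using exp_converges[of "1::real"] by (simp add: scaleR_conv_of_real)
  then have "(\<lambda>n. inverse (fact (Suc n))) sums (exp 1 - 1 :: real)"
    by (subst sums_Suc_iff) simp
  then have tail: "(\<lambda>n. M * inverse (fact (Suc n))) sums (M * (exp 1 - 1))"
    by (rule sums_mult)
  have d_nonneg: "0 \<le> d n" for n using g_pos by (simp add: d_def less_imp_le)
  \<comment> \<open>Deliberately coarse: the square of (n + 2)! is lowered to (n + 1)!, so that the
    majorant sums to \<open>M\<close> times the constant e - 1 of the hypothesis.\<close>
  have d_bound: "d (Suc (Suc n)) \<le> M * inverse (fact (Suc n))" for n
  proof -
    have f1: "fact (Suc n) \<le> (fact (Suc (Suc n)) :: real)" by (rule fact_mono) simp
    have "(fact (Suc n) :: real) * 1 \<le> fact (Suc (Suc n)) * fact (Suc (Suc n))"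
      by (rule mult_mono[OF f1]) (simp_all only: fact_ge_1 fact_ge_zero zero_le_one)
    then have "fact (Suc n) \<le> (fact (Suc (Suc n)) :: real)\<^sup>2" by (simp only: power2_eq_square mult_1_right)
    moreover have "g (Suc (Suc n)) / g 0 \<le> M"
      unfolding M_def using g_pos[of 0] anti[of 2 "Suc (Suc n)"] by (intro divide_right_mono) auto
    ultimately have "g (Suc (Suc n)) / g 0 / (fact (Suc (Suc n)))\<^sup>2 \<le> M / fact (Suc n)"
      using M by (intro frac_le) (simp_all only: fact_gt_zero)
    then show ?thesis by (simp only: d_def divide_inverse)
  qed
  have sum_d2: "summable (\<lambda>n. d (Suc (Suc n)))"
    by (rule summable_comparison_test'[OF sums_summable[OF tail]])
      (use d_nonneg d_bound in \<open>simp only: real_norm_def abs_of_nonneg\<close>)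
  then have sum_d1: "summable (\<lambda>n. d (Suc n))" and sum_d: "summable d"
    by (simp_all only: summable_Suc_iff[of d] summable_Suc_iff[of "\<lambda>n. d (Suc n)"])
  \<comment> \<open>The term \<open>d 1\<close>, equal to \<open>g 1 / g 0\<close>, is kept exact
    and only the later ones are estimated, which reproduces the left side of \<open>key\<close>
    divided by \<open>g 0\<close>.\<close>
  have "(\<Sum>n. d (Suc n)) = (\<Sum>n. d (Suc (Suc n))) + d 1"
    using suminf_split_head[OF sum_d1] by simp
  also have "(\<Sum>n. d (Suc (Suc n))) \<le> M * (exp 1 - 1)"
    using suminf_le[OF d_bound sum_d2 sums_summable[OF tail]] sums_unique[OF tail] by simp
  also have "M * (exp 1 - 1) + d 1 = (g 1 + (exp 1 - 1) * g 2) / g 0"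
    by (simp add: M_def d_def add_divide_distrib)
  also have "\<dots> \<le> 1" using key g_pos[of 0] by simp
  finally have le1: "(\<Sum>n. d (Suc n)) \<le> 1" by simp
  show ?thesis
  proof (rule convex_in_half_disc_of_coefficients[OF d_nonneg _ sum_d le1])
    show "d 0 = 1" using g_pos[of 0] by (simp add: d_def)
    fix z :: complex assume z: "norm z < 1"
    have "summable (\<lambda>k. complex_of_real (d k) * z ^ k / of_nat (Suc k))"
    proof (rule summable_comparison_test'[OF sum_d])
      fix n
      have "norm z ^ n / real (Suc n) \<le> 1 / 1"
        using z by (intro frac_le power_le_one) auto
      then have "d n * (norm z ^ n / real (Suc n)) \<le> d n * 1"
        using d_nonneg by (intro mult_left_mono) auto
      then show "norm (complex_of_real (d n) * z ^ n / of_nat (Suc n)) \<le> d n"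
        using d_nonneg[of n] by (simp add: norm_mult norm_divide norm_power del: of_nat_Suc)
    qed
    then show "fox_wright_normalized (map (\<lambda>i. (a i, A)) [1..<p+1])
        ((2, 1) # map (\<lambda>i. (b i, A)) [1..<p+1]) z
      = (\<Sum>n. of_real (d n) / of_nat (Suc n) * z ^ Suc n)"
      using g_pos[of 0] unfolding d_def
      by (intro fox_wright_normalized_equal_steps g_def) simp_all
  qed
qed

end
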